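(* Fix $p\in(0,\tfrac12]$. Any weakly global sequence $(f_n)$ of Boolean functions $f_n\colon\{0,1\}^n\to\{0,1\}$ is noise sensitive; that is, for every fixed $\rho\in(0,1)$, \[\mathrm{Stab}_\rho(f_n)=\mu_p(f_n)^2+o(\mu_p(f_n))\quad\text{as }n\to\infty.\]
   Context: $\mu_p$ is the $p$-biased product measure on $\{0,1\}^n$ and $\mu_p(f)=\mathbb{E}_{\mu_p}[f]$. For $J\subseteq[n]$, $f_{J\to1}$ is the restriction of $f$ setting coordinates of $J$ to $1$. The noise operator is $\mathrm{T}_\rho f(x)=\mathbb{E}_{\mathbf{y}\sim N_\rho(x)}[f(\mathbf{y})]$, where $\mathbf{y}$ is obtained independently for each $i$ by setting $\mathbf{y}_i=x_i$ with probability $\rho$ and otherwise resampling $\mathbf{y}_i$ with $\Pr[\mathbf{y}_i=1]=p$; the noise stability is $\mathrm{Stab}_\rho(f)=\mathbb{E}_{\mathbf{x}\sim\mu_p}[f(\mathbf{x})\mathrm{T}_\rho f(\mathbf{x})]$. A sequence $(f_n)$ is weakly global if $\mu_p(f_n)=o(1)$ and for every $\varepsilon,C>0$ there is $n_0$ such that $\mu_p((f_n)_{J\to1})<\varepsilon$ for all $n>n_0$ and all $J\subseteq[n]$ with $|J|\le C$. *)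

theory Defs
  imports "HOL-Probability.Probability" "HOL-Library.Landau_Symbols"
begin

text \<open>
  A point of \<open>{0,1}\<^sup>I\<close>, for a finite set \<open>I\<close> of coordinates, is a function
  \<open>nat \<Rightarrow> bool\<close> with the default value \<^const>\<open>False\<close> outside \<open>I\<close>, as in \<^const>\<open>Pi_pmf\<close>.
  The cube \<open>{0,1}\<^sup>n\<close> is the case \<open>I = {1..n}\<close>. Functions on a cube are real-valued, and only
  their values on the cube matter below. The index set is a parameter because a restriction
  of a function on \<open>{0,1}\<^sup>I\<close> lives on the smaller cube \<open>{0,1}\<^bsup>I - J\<^esup>\<close>.
\<close>

definition cube :: "nat set \<Rightarrow> (nat \<Rightarrow> bool) set" where
  "cube I = PiE_dflt I False (\<lambda>_. UNIV)"

definition biased_pmf :: "real \<Rightarrow> nat set \<Rightarrow> (nat \<Rightarrow> bool) pmf" where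
  "biased_pmf p I = Pi_pmf I False (\<lambda>_. bernoulli_pmf p)"

definition \<mu> :: "real \<Rightarrow> nat set \<Rightarrow> ((nat \<Rightarrow> bool) \<Rightarrow> real) \<Rightarrow> real" where
  "\<mu> p I f = measure_pmf.expectation (biased_pmf p I) f"

definition restrict_to_1 :: "((nat \<Rightarrow> bool) \<Rightarrow> real) \<Rightarrow> nat set \<Rightarrow> ((nat \<Rightarrow> bool) \<Rightarrow> real)" where
  "restrict_to_1 f J = (\<lambda>x. f (\<lambda>i. if i \<in> J then True else x i))"

definition noise_pmf :: "real \<Rightarrow> real \<Rightarrow> nat set \<Rightarrow> (nat \<Rightarrow> bool) \<Rightarrow> (nat \<Rightarrow> bool) pmf" where
  "noise_pmf p \<rho> I x = Pi_pmf I False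
     (\<lambda>i. bind_pmf (bernoulli_pmf \<rho>)
            (\<lambda>keep. if keep then return_pmf (x i) else bernoulli_pmf p))"

definition noise_op ::
    "real \<Rightarrow> real \<Rightarrow> nat set \<Rightarrow> ((nat \<Rightarrow> bool) \<Rightarrow> real) \<Rightarrow> ((nat \<Rightarrow> bool) \<Rightarrow> real)" where
  "noise_op p \<rho> I f = (\<lambda>x. measure_pmf.expectation (noise_pmf p \<rho> I x) f)"

definition Stab :: "real \<Rightarrow> real \<Rightarrow> nat set \<Rightarrow> ((nat \<Rightarrow> bool) \<Rightarrow> real) \<Rightarrow> real" where
  "Stab p \<rho> I f = measure_pmf.expectation (biased_pmf p I) (\<lambda>x. f x * noise_op p \<rho> I f x)"

definition weakly_global :: "real \<Rightarrow> (nat \<Rightarrow> (nat \<Rightarrow> bool) \<Rightarrow> real) \<Rightarrow> bool" where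
  "weakly_global p f \<longleftrightarrow>
     (\<lambda>n. \<mu> p {1..n} (f n)) \<in> o(\<lambda>_. 1) \<and>
     (\<forall>\<epsilon>>0. \<forall>C::real. C > 0 \<longrightarrow>
        (\<exists>n0. \<forall>n>n0. \<forall>J\<subseteq>{1..n}. real (card J) \<le> C \<longrightarrow>
           \<mu> p ({1..n} - J) (restrict_to_1 (f n) J) < \<epsilon>))"

definition noise_sensitive :: "real \<Rightarrow> (nat \<Rightarrow> (nat \<Rightarrow> bool) \<Rightarrow> real) \<Rightarrow> bool" where
  "noise_sensitive p f \<longleftrightarrow>
     (\<forall>\<rho>. 0 < \<rho> \<and> \<rho> < 1 \<longrightarrow>
        (\<lambda>n. Stab p \<rho> {1..n} (f n) - (\<mu> p {1..n} (f n))\<^sup>2) \<in> o(\<lambda>n. \<mu> p {1..n} (f n)))"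

end

theory Submission
  imports Defs
begin

text \<open>
  For \<open>[0,1]\<close>-valued \<open>f\<close>, small-set expansion gives \<open>Stab\<^sub>\<rho>(f) \<le> \<mu>(f)\<^bsup>1+\<delta>\<^esup>\<close>, with \<open>\<delta> > 0\<close> depending
  only on \<open>p\<close> and \<open>\<rho>\<close>; this is \<open>o(\<mu>(f))\<close> as \<open>\<mu>(f) \<rightarrow> 0\<close>.
  With \<open>s = (1 + \<delta>)/2\<close>, the two-function form \<open>E[f T\<^sub>\<rho> g] \<le> \<mu>(f)\<^sup>s \<mu>(g)\<^sup>s\<close> tensorizes by conditioning
  on one coordinate, so only an inequality on a single biased bit is needed. By Cauchy--Schwarz
  this reduces to \<open>f = g\<close>, where it says that the Jensen gap of \<open>t \<mapsto> t\<^bsup>1+\<delta>\<^esup>\<close> at \<open>a, b\<close> is at most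
  \<open>(1 - \<rho>) p (1 - p) (a\<^sup>s - b\<^sup>s)\<^sup>2\<close>; Bernoulli's inequality bounds this gap by
  \<open>\<delta> p (1 - p) (a - b)\<^sup>2\<close> when the mean is \<open>1\<close>.
\<close>

section \<open>The inequality on one bit\<close>

text \<open>Weighted AM-GM for \<open>x\<close> and \<open>1\<close> with weights \<open>s\<close>
  and \<open>1 - s\<close>. Young's inequality wants positive arguments, hence the separate case
  \<open>x = 0\<close>.\<close>

lemma powr_le_Bernoulli:
  fixes x s :: real
  assumes "0 \<le> x" "0 \<le> s" "s \<le> 1"
  shows "x powr s \<le> 1 + s * (x - 1)"
  using Youngs_inequality_0[of s "1 - s" x 1] assms
  by (cases "x = 0") (simp_all add: algebra_simps)

text \<open>Bernoulli applied to \<open>t powr \<delta>\<close> gives a quadratic majorant of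
  \<open>t powr (1 + \<delta>)\<close> touching it at the mean \<open>1\<close>. On averaging, the
  linear term vanishes and the quadratic term becomes \<delta> times the variance.\<close>

lemma Jensen_gap_powr_le:
  fixes p a b \<delta> :: real
  assumes p: "0 \<le> p" "p \<le> 1" and ab: "0 \<le> a" "0 \<le> b" and mean: "p * a + (1 - p) * b = 1"
    and \<delta>: "0 \<le> \<delta>" "\<delta> \<le> 1"
  shows "p * a powr (1 + \<delta>) + (1 - p) * b powr (1 + \<delta>) - 1 \<le> \<delta> * (p * (1 - p) * (a - b)\<^sup>2)"
proof -
  have powr_le: "t powr (1 + \<delta>) \<le> t + \<delta> * (t - 1) + \<delta> * (t - 1)\<^sup>2" if "0 \<le> t" for t :: real
  proof -
    have "t powr (1 + \<delta>) = t * t powr \<delta>"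
      using that by (simp add: powr_add powr_one)
    also have "\<dots> \<le> t * (1 + \<delta> * (t - 1))"
      using that \<delta> by (intro mult_left_mono powr_le_Bernoulli)
    also have "\<dots> = t + \<delta> * (t - 1) + \<delta> * (t - 1)\<^sup>2"
      by (simp add: algebra_simps power2_eq_square)
    finally show ?thesis .
  qed
  have b1: "b - 1 = p * (b - a)" and a1: "a - 1 = (1 - p) * (a - b)"
    using mean by (simp_all add: algebra_simps)
  have "p * a powr (1 + \<delta>) + (1 - p) * b powr (1 + \<delta>)
      \<le> p * (a + \<delta> * (a - 1) + \<delta> * (a - 1)\<^sup>2) + (1 - p) * (b + \<delta> * (b - 1) + \<delta> * (b - 1)\<^sup>2)"
    using p ab by (intro add_mono mult_left_mono powr_le) auto
  also have "\<dots> = (p * a + (1 - p) * b) + \<delta> * (p * (a - 1) + (1 - p) * (b - 1))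
      + \<delta> * (p * (a - 1)\<^sup>2 + (1 - p) * (b - 1)\<^sup>2)"
    by (simp add: algebra_simps)
  also have "\<dots> = 1 + \<delta> * (p * (1 - p) * (a - b)\<^sup>2)"
    unfolding a1 b1 mean by (simp add: algebra_simps power2_eq_square)
  finally show ?thesis by simp
qed

text \<open>After factoring out \<open>a\<close>, it remains to see
  \<open>1 - r \<le> 2 * (1 - r powr s)\<close> for \<open>r = b / a\<close>, which is Bernoulli
  together with \<open>2 * s \<ge> 1\<close>. The leftover factor \<open>a powr (1 - s)\<close> is
  at most \<open>M\<close> because \<open>M \<ge> 1\<close>.\<close>

lemma diff_le_diff_powr:
  fixes a b s M :: real
  assumes "0 \<le> b" "b \<le> a" "a \<le> M" "1 \<le> M" "1 / 2 \<le> s" "s \<le> 1"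
  shows "a - b \<le> 2 * M * (a powr s - b powr s)"
proof (cases "a = 0")
  case True
  then show ?thesis using assms by simp
next
  case False
  then have a: "0 < a" using assms by simp
  have bern: "(b / a) powr s \<le> 1 + s * (b / a - 1)"
    using assms a by (intro powr_le_Bernoulli) auto
  have "a powr (1 - s) \<le> M powr (1 - s)"
    using a assms by (intro powr_mono2) auto
  also have "\<dots> \<le> M powr 1"
    using assms by (intro powr_mono) auto
  finally have M: "a powr (1 - s) \<le> M" using assms by simp
  have "a - b = a * (1 - b / a)"
    using a by (simp add: field_simps)
  also have "\<dots> \<le> a * (2 * (1 - (b / a) powr s))"
  proof (intro mult_left_mono)
    have "1 * (1 - b / a) \<le> 2 * s * (1 - b / a)"
      using assms a by (intro mult_right_mono) auto
    also have "\<dots> = 2 * (1 - (1 + s * (b / a - 1)))"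
      by (simp add: algebra_simps)
    also have "\<dots> \<le> 2 * (1 - (b / a) powr s)"
      using bern by simp
    finally show "1 - b / a \<le> 2 * (1 - (b / a) powr s)" by simp
  qed (use a in simp)
  also have "\<dots> = 2 * a powr (1 - s) * (a powr s - b powr s)"
    using a assms by (simp add: powr_divide powr_diff field_simps)
  also have "\<dots> \<le> 2 * M * (a powr s - b powr s)"
    using M assms a by (intro mult_right_mono) (auto intro: powr_mono2)
  finally show ?thesis .
qed

lemma diff_square_le_diff_powr_square:
  fixes a b s M :: real
  assumes "0 \<le> a" "a \<le> M" "0 \<le> b" "b \<le> M" "1 \<le> M" "1 / 2 \<le> s" "s \<le> 1"
  shows "(a - b)\<^sup>2 \<le> 4 * M\<^sup>2 * (a powr s - b powr s)\<^sup>2"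
  using assms
proof (induction a b rule: linorder_wlog)
  case (le a b)
  then have "(b - a)\<^sup>2 \<le> (2 * M * (b powr s - a powr s))\<^sup>2"
    by (intro power_mono diff_le_diff_powr) auto
  then show ?case
    by (simp add: power2_commute power_mult_distrib)
next
  case (sym a b)
  then show ?case by (simp add: power2_commute)
qed

text \<open>The \<delta> of small-set expansion. The factor \<open>p\<^sup>2 / 4\<close> cancels the
  loss \<open>4 * (1 / p)\<^sup>2\<close> incurred in passing from \<open>(a - b)\<^sup>2\<close> to
  \<open>(a powr s - b powr s)\<^sup>2\<close>, leaving exactly \<open>1 - \<rho>\<close>.\<close>

definition noise_gain :: "real \<Rightarrow> real \<Rightarrow> real" where
  "noise_gain p \<rho> = p\<^sup>2 * (1 - \<rho>) / 4"

lemma noise_gain_pos: "0 < p \<Longrightarrow> \<rho> < 1 \<Longrightarrow> 0 < noise_gain p \<rho>"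
  by (simp add: noise_gain_def)

lemma noise_gain_le_1:
  assumes "0 < p" "p \<le> 1" "0 \<le> \<rho>" "\<rho> \<le> 1"
  shows "noise_gain p \<rho> \<le> 1"
proof -
  have "p\<^sup>2 * (1 - \<rho>) \<le> 1 * 1"
    using assms by (intro mult_mono power_le_one) auto
  then show ?thesis by (simp add: noise_gain_def)
qed

lemma bit_hypercontractive_normalized:
  fixes p \<rho> a b :: real
  defines "s \<equiv> (1 + noise_gain p \<rho>) / 2"
  assumes p: "0 < p" "p \<le> 1 / 2" and \<rho>: "0 < \<rho>" "\<rho> < 1"
    and ab: "0 \<le> a" "0 \<le> b" and mean: "p * a + (1 - p) * b = 1"
  shows "(p * a powr s + (1 - p) * b powr s)\<^sup>2 + \<rho> * (p * (1 - p)) * (a powr s - b powr s)\<^sup>2 \<le> 1"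
proof -
  define \<delta> where "\<delta> = noise_gain p \<rho>"
  have \<delta>: "0 < \<delta>" "\<delta> \<le> 1"
    using p \<rho> by (auto simp: \<delta>_def noise_gain_pos noise_gain_le_1)
  have s: "1 / 2 \<le> s" "s \<le> 1" "s + s = 1 + \<delta>"
    using \<delta> by (auto simp: s_def \<delta>_def)
  \<comment> \<open>Since \<open>p \<le> 1 / 2\<close>, each bit value has weight at least
    \<open>p\<close>, so mean \<open>1\<close> bounds both \<open>a\<close> and \<open>b\<close> by
    \<open>1 / p\<close>.\<close>
  have "0 \<le> p * a" "0 \<le> (1 - p) * b" "p * b \<le> (1 - p) * b"
    using p ab by (auto intro: mult_right_mono)
  then have "p * a \<le> 1" "p * b \<le> 1"
    using mean by linarith+
  then have le: "a \<le> 1 / p" "b \<le> 1 / p"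
    using p by (auto simp: field_simps)
  have sq: "(t powr s)\<^sup>2 = t powr (1 + \<delta>)" for t :: real
    by (simp add: power2_eq_square powr_add[symmetric] s)
  have "p * a powr (1 + \<delta>) + (1 - p) * b powr (1 + \<delta>) - 1 \<le> \<delta> * (p * (1 - p) * (a - b)\<^sup>2)"
    using p ab mean \<delta> by (intro Jensen_gap_powr_le) auto
  also have "\<dots> \<le> \<delta> * (p * (1 - p) * (4 * (1 / p)\<^sup>2 * (a powr s - b powr s)\<^sup>2))"
    using p ab \<delta> s le
    by (intro mult_left_mono diff_square_le_diff_powr_square mult_nonneg_nonneg) auto
  also have "\<dots> = (1 - \<rho>) * (p * (1 - p) * (a powr s - b powr s)\<^sup>2)"
    using p by (simp add: \<delta>_def noise_gain_def power_divide)
  \<comment> \<open>The squared mean of the \<open>s\<close>-th powers is their second moment minus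
    their variance, so the claim is this bound rearranged.\<close>
  finally show ?thesis
    unfolding sq[symmetric] by (simp add: algebra_simps power2_eq_square)
qed

text \<open>Both sides are homogeneous of degree \<open>2 * s\<close> in \<open>a\<close> and
  \<open>b\<close>, so dividing by the mean \<open>m\<close> reduces to the normalized case;
  \<open>m = 0\<close> forces \<open>a = b = 0\<close>.\<close>

lemma bit_hypercontractive:
  fixes p \<rho> a b :: real
  defines "s \<equiv> (1 + noise_gain p \<rho>) / 2"
  assumes p: "0 < p" "p \<le> 1 / 2" and \<rho>: "0 < \<rho>" "\<rho> < 1" and ab: "0 \<le> a" "0 \<le> b"
  shows "(p * a powr s + (1 - p) * b powr s)\<^sup>2 + \<rho> * (p * (1 - p)) * (a powr s - b powr s)\<^sup>2
    \<le> ((p * a + (1 - p) * b) powr s)\<^sup>2"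
proof -
  define m where "m = p * a + (1 - p) * b"
  have nonneg: "0 \<le> p * a" "0 \<le> (1 - p) * b"
    using p ab by auto
  show ?thesis
  proof (cases "m = 0")
    case True
    then have "p * a = 0" "(1 - p) * b = 0"
      using nonneg unfolding m_def by linarith+
    then have "a = 0" "b = 0" using p by auto
    then show ?thesis by simp
  next
    case False
    then have m: "0 < m" using nonneg by (auto simp: m_def)
    define c where "c = m powr s"
    have c: "0 < c" using m by (simp add: c_def)
    have div: "(t / m) powr s = t powr s / c" if "0 \<le> t" for t
      using that m by (simp add: c_def powr_divide)
    have "p * (a / m) + (1 - p) * (b / m) = (p * a + (1 - p) * b) / m"
      by (simp add: add_divide_distrib)
    also have "\<dots> = 1" using m by (simp add: m_def)
    finally have mean: "p * (a / m) + (1 - p) * (b / m) = 1" .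
    have "0 \<le> a / m" "0 \<le> b / m" using ab m by simp_all
    note bit_hypercontractive_normalized[OF p \<rho> this mean, folded s_def]
    also have "p * (a / m) powr s + (1 - p) * (b / m) powr s = (p * a powr s + (1 - p) * b powr s) / c"
      by (simp add: div ab add_divide_distrib)
    also have "(a / m) powr s - (b / m) powr s = (a powr s - b powr s) / c"
      by (simp add: div ab diff_divide_distrib)
    finally have "((p * a powr s + (1 - p) * b powr s)\<^sup>2
        + \<rho> * (p * (1 - p)) * (a powr s - b powr s)\<^sup>2) / c\<^sup>2 \<le> 1"
      by (simp only: power_divide times_divide_eq_right add_divide_distrib[symmetric])
    then show ?thesis
      using c by (simp add: divide_le_eq_1 m_def c_def)
  qed
qed

text \<open>By Lagrange's identity, the product of the two quadratic forms exceeds the squared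
  bilinear form by \<open>c * (m * e - n * d)\<^sup>2\<close>.\<close>

lemma Cauchy_Schwarz_weighted_pair:
  fixes c d e m n X Y :: real
  assumes "0 \<le> c" "m\<^sup>2 + c * d\<^sup>2 \<le> X\<^sup>2" "n\<^sup>2 + c * e\<^sup>2 \<le> Y\<^sup>2" "0 \<le> X" "0 \<le> Y"
  shows "m * n + c * (d * e) \<le> X * Y"
proof -
  have "0 \<le> c * (m * e - n * d)\<^sup>2" using assms by simp
  then have "(m * n + c * (d * e))\<^sup>2 \<le> (m\<^sup>2 + c * d\<^sup>2) * (n\<^sup>2 + c * e\<^sup>2)"
    by (simp add: algebra_simps power2_eq_square)
  also have "\<dots> \<le> X\<^sup>2 * Y\<^sup>2"
    using assms by (intro mult_mono) auto
  finally have "(m * n + c * (d * e))\<^sup>2 \<le> (X * Y)\<^sup>2" by (simp add: power_mult_distrib)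
  then show ?thesis
    by (rule power2_le_imp_le) (use assms in simp)
qed

text \<open>The left-hand side is the one-bit value of E[u T v] for
  \<open>u = (a powr s, b powr s)\<close> and \<open>v = (c powr s, d powr s)\<close>: the product
  of the means plus \<rho> times the covariance.\<close>

lemma bit_hypercontractive_bilinear:
  fixes p \<rho> a b c d :: real
  defines "s \<equiv> (1 + noise_gain p \<rho>) / 2"
  assumes "0 < p" "p \<le> 1 / 2" "0 < \<rho>" "\<rho> < 1" and "0 \<le> a" "0 \<le> b" "0 \<le> c" "0 \<le> d"
  shows "(p * a powr s + (1 - p) * b powr s) * (p * c powr s + (1 - p) * d powr s)
      + \<rho> * (p * (1 - p)) * ((a powr s - b powr s) * (c powr s - d powr s))
    \<le> (p * a + (1 - p) * b) powr s * (p * c + (1 - p) * d) powr s"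
  using assms unfolding s_def
  by (intro Cauchy_Schwarz_weighted_pair bit_hypercontractive) auto

section \<open>Conditioning on one coordinate\<close>

lemma cube_upd: "x \<in> cube I \<Longrightarrow> x(i := b) \<in> cube (insert i I)"
  by (auto simp: cube_def PiE_dflt_def)

lemma set_biased_pmf_subset_cube: "finite I \<Longrightarrow> set_pmf (biased_pmf p I) \<subseteq> cube I"
  using set_Pi_pmf_subset' by (force simp: biased_pmf_def cube_def PiE_dflt_def)

lemma set_noise_pmf_subset_cube: "finite I \<Longrightarrow> set_pmf (noise_pmf p \<rho> I x) \<subseteq> cube I"
  using set_Pi_pmf_subset' by (force simp: noise_pmf_def cube_def PiE_dflt_def)

lemma finite_cube: "finite I \<Longrightarrow> finite (cube I)"
  unfolding cube_def by (intro finite_PiE_dflt) auto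

lemma finite_set_biased_pmf: "finite I \<Longrightarrow> finite (set_pmf (biased_pmf p I))"
  using set_biased_pmf_subset_cube finite_cube finite_subset by metis

lemma finite_set_noise_pmf: "finite I \<Longrightarrow> finite (set_pmf (noise_pmf p \<rho> I x))"
  using set_noise_pmf_subset_cube finite_cube finite_subset by metis

text \<open>Stated for an arbitrary family \<open>P\<close> so as to serve both the biased measure
  and the noise kernel.\<close>

lemma expectation_Pi_pmf_insert_bool:
  fixes h :: "(nat \<Rightarrow> bool) \<Rightarrow> real"
  assumes "finite I" "i \<notin> I" "finite (set_pmf (Pi_pmf I False P))"
  shows "measure_pmf.expectation (Pi_pmf (insert i I) False P) h =
    pmf (P i) True * measure_pmf.expectation (Pi_pmf I False P) (\<lambda>x. h (x(i := True))) +
    pmf (P i) False * measure_pmf.expectation (Pi_pmf I False P) (\<lambda>x. h (x(i := False)))"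
proof -
  have "Pi_pmf (insert i I) False P = P i \<bind> (\<lambda>b. map_pmf (\<lambda>x. x(i := b)) (Pi_pmf I False P))"
    using assms by (simp add: Pi_pmf_insert' map_pmf_def)
  then show ?thesis
    using assms by (subst \<open>Pi_pmf (insert i I) False P = _\<close>, subst pmf_expectation_bind[where A = UNIV])
      (auto simp: UNIV_bool)
qed

lemma \<mu>_insert:
  assumes "finite I" "i \<notin> I" "0 \<le> p" "p \<le> 1"
  shows "\<mu> p (insert i I) f = p * \<mu> p I (\<lambda>x. f (x(i := True))) + (1 - p) * \<mu> p I (\<lambda>x. f (x(i := False)))"
  using assms finite_set_biased_pmf[of I p] expectation_Pi_pmf_insert_bool[of I i "\<lambda>_. bernoulli_pmf p" f]
  by (simp add: \<mu>_def biased_pmf_def)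

lemma \<mu>_add: "finite I \<Longrightarrow> \<mu> p I (\<lambda>x. f x + g x) = \<mu> p I f + \<mu> p I g"
  unfolding \<mu>_def by (intro Bochner_Integration.integral_add integrable_measure_pmf_finite finite_set_biased_pmf)

lemma \<mu>_cmult: "\<mu> p I (\<lambda>x. c * f x) = c * \<mu> p I f"
  by (simp add: \<mu>_def)

lemma \<mu>_nonneg:
  assumes "finite I" "\<And>x. x \<in> cube I \<Longrightarrow> 0 \<le> f x"
  shows "0 \<le> \<mu> p I f"
  unfolding \<mu>_def using assms set_biased_pmf_subset_cube[of I p]
  by (intro integral_nonneg_AE) (auto simp: AE_measure_pmf_iff)

lemma noise_op_nonneg:
  assumes "finite I" "\<And>x. x \<in> cube I \<Longrightarrow> 0 \<le> f x"
  shows "0 \<le> noise_op p \<rho> I f x"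
  unfolding noise_op_def using assms set_noise_pmf_subset_cube[of I p \<rho> x]
  by (intro integral_nonneg_AE) (auto simp: AE_measure_pmf_iff)

lemma pmf_noise_bit:
  assumes "0 \<le> p" "p \<le> 1" "0 \<le> \<rho>" "\<rho> \<le> 1"
  shows "pmf (bind_pmf (bernoulli_pmf \<rho>) (\<lambda>keep. if keep then return_pmf b else bernoulli_pmf p)) c
    = \<rho> * of_bool (b = c) + (1 - \<rho>) * (if c then p else 1 - p)"
  using assms by (cases c) (auto simp: pmf_bind UNIV_bool)

lemma noise_op_insert:
  assumes "finite I" "i \<notin> I" "0 \<le> p" "p \<le> 1" "0 \<le> \<rho>" "\<rho> \<le> 1"
  shows "noise_op p \<rho> (insert i I) g (x(i := b)) =
    (\<rho> * of_bool b + (1 - \<rho>) * p) * noise_op p \<rho> I (\<lambda>x. g (x(i := True))) x +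
    (\<rho> * of_bool (\<not> b) + (1 - \<rho>) * (1 - p)) * noise_op p \<rho> I (\<lambda>x. g (x(i := False))) x"
proof -
  let ?P = "\<lambda>x i. bind_pmf (bernoulli_pmf \<rho>) (\<lambda>keep. if keep then return_pmf (x i) else bernoulli_pmf p)"
  \<comment> \<open>As \<open>i \<notin> I\<close>, the noise on \<open>I\<close> does not see the
    bit at \<open>i\<close>.\<close>
  have "Pi_pmf I False (?P (x(i := b))) = Pi_pmf I False (?P x)"
    using assms by (intro Pi_pmf_cong refl) (metis fun_upd_other)
  then show ?thesis
    using assms finite_set_noise_pmf[of I p \<rho> x]
      expectation_Pi_pmf_insert_bool[of I i "?P (x(i := b))" g]
    by (simp add: noise_op_def noise_pmf_def pmf_noise_bit)
qed

text \<open>Two functions are needed even for \<open>Stab\<close>: the two correlated points may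
  differ at a coordinate, and conditioning on it then yields different slices of the same
  \<open>f\<close>.\<close>

definition noise_form where
  "noise_form p \<rho> I f g = \<mu> p I (\<lambda>x. f x * noise_op p \<rho> I g x)"

lemma Stab_eq_noise_form: "Stab p \<rho> I f = noise_form p \<rho> I f f"
  by (simp add: Stab_def noise_form_def \<mu>_def)

text \<open>The outer weights are the law of the bit of \<open>x\<close> at \<open>i\<close>, the
  inner ones the law of the noisy bit given that bit.\<close>

lemma noise_form_insert:
  assumes "finite I" "i \<notin> I" "0 \<le> p" "p \<le> 1" "0 \<le> \<rho>" "\<rho> \<le> 1"
  defines "N \<equiv> \<lambda>f g a b. noise_form p \<rho> I (\<lambda>x. f (x(i := a))) (\<lambda>x. g (x(i := b)))"
  shows "noise_form p \<rho> (insert i I) f g =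
    p * ((\<rho> + (1 - \<rho>) * p) * N f g True True + (1 - \<rho>) * (1 - p) * N f g True False) +
    (1 - p) * ((1 - \<rho>) * p * N f g False True + (\<rho> + (1 - \<rho>) * (1 - p)) * N f g False False)"
proof -
  have "\<mu> p I (\<lambda>x. f (x(i := a)) * (c * noise_op p \<rho> I (\<lambda>x. g (x(i := True))) x
        + d * noise_op p \<rho> I (\<lambda>x. g (x(i := False))) x))
      = c * N f g a True + d * N f g a False" for a c d
    using assms(1) by (simp add: N_def noise_form_def distrib_left mult.left_commute \<mu>_add \<mu>_cmult)
  then show ?thesis
    using assms unfolding noise_form_def
    by (subst \<mu>_insert) (simp_all add: noise_op_insert)
qed

section \<open>Small-set expansion\<close>

theorem noise_form_le_powr:
  fixes p \<rho> :: real
  defines "s \<equiv> (1 + noise_gain p \<rho>) / 2"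
  assumes p: "0 < p" "p \<le> 1 / 2" and \<rho>: "0 < \<rho>" "\<rho> < 1" and "finite I"
    and "\<And>x. x \<in> cube I \<Longrightarrow> f x \<in> {0..1}" "\<And>x. x \<in> cube I \<Longrightarrow> g x \<in> {0..1}"
  shows "noise_form p \<rho> I f g \<le> \<mu> p I f powr s * \<mu> p I g powr s"
  using \<open>finite I\<close> assms(7,8)
proof (induction I arbitrary: f g rule: finite_induct)
  case empty
  have s: "0 \<le> s" "s \<le> 1"
    using p \<rho> noise_gain_pos[of p \<rho>] noise_gain_le_1[of p \<rho>] by (auto simp: s_def)
  \<comment> \<open>On the empty cube, which consists of the all-\<open>False\<close> point, each
    function is a single number, and this bound applies to both factors. The upper bound
    \<open>1\<close> on the values enters here.\<close>
  have le: "t \<le> t powr s" if "0 \<le> t" "t \<le> 1" for t :: real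
    using powr_mono'[of s 1 t] that s by simp
  have "(\<lambda>_. False) \<in> cube {}"
    by (simp add: cube_def PiE_dflt_def)
  then show ?case
    using empty
    by (auto simp: noise_form_def noise_op_def \<mu>_def biased_pmf_def noise_pmf_def intro!: mult_mono le)
next
  case (insert i I)
  define F G where "F = (\<lambda>b x. f (x(i := b)))" and "G = (\<lambda>b x. g (x(i := b)))"
  have F: "F b x \<in> {0..1}" and G: "G b x \<in> {0..1}" if "x \<in> cube I" for b x
    unfolding F_def G_def using that by (auto intro!: insert.prems cube_upd simp del: atLeastAtMost_iff)
  have nonneg: "0 \<le> \<mu> p I (F b)" "0 \<le> \<mu> p I (G b)" for b
    using F G insert.hyps by (auto intro!: \<mu>_nonneg)
  define u v where "u = (\<lambda>b. \<mu> p I (F b) powr s)" and "v = (\<lambda>b. \<mu> p I (G b) powr s)"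
  have N: "noise_form p \<rho> I (F a) (G b) \<le> u a * v b" for a b
    unfolding u_def v_def using F G by (rule insert.IH)
  have "noise_form p \<rho> (insert i I) f g =
      p * ((\<rho> + (1 - \<rho>) * p) * noise_form p \<rho> I (F True) (G True)
        + (1 - \<rho>) * (1 - p) * noise_form p \<rho> I (F True) (G False)) +
      (1 - p) * ((1 - \<rho>) * p * noise_form p \<rho> I (F False) (G True)
        + (\<rho> + (1 - \<rho>) * (1 - p)) * noise_form p \<rho> I (F False) (G False))"
    unfolding F_def G_def using insert.hyps p \<rho> by (intro noise_form_insert) auto
  \<comment> \<open>All four joint weights are nonnegative, so the induction hypothesis applies to
    each pair of slices.\<close>
  also have "\<dots> \<le> p * ((\<rho> + (1 - \<rho>) * p) * (u True * v True) + (1 - \<rho>) * (1 - p) * (u True * v False))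
      + (1 - p) * ((1 - \<rho>) * p * (u False * v True) + (\<rho> + (1 - \<rho>) * (1 - p)) * (u False * v False))"
    using p \<rho> by (intro add_mono mult_left_mono N) auto
  \<comment> \<open>Regrouping the weights exposes the left-hand side of the one-bit
    inequality.\<close>
  also have "\<dots> = (p * u True + (1 - p) * u False) * (p * v True + (1 - p) * v False)
      + \<rho> * (p * (1 - p)) * ((u True - u False) * (v True - v False))"
    by (simp add: algebra_simps)
  also have "\<dots> \<le> (p * \<mu> p I (F True) + (1 - p) * \<mu> p I (F False)) powr s
      * (p * \<mu> p I (G True) + (1 - p) * \<mu> p I (G False)) powr s"
    unfolding u_def v_def s_def using p \<rho> nonneg by (intro bit_hypercontractive_bilinear) auto
  also have "\<dots> = \<mu> p (insert i I) f powr s * \<mu> p (insert i I) g powr s"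
    unfolding F_def G_def using insert.hyps p by (simp add: \<mu>_insert)
  finally show ?case .
qed

corollary Stab_le_powr:
  assumes "0 < p" "p \<le> 1 / 2" "0 < \<rho>" "\<rho> < 1" "finite I" "\<And>x. x \<in> cube I \<Longrightarrow> f x \<in> {0..1}"
  shows "Stab p \<rho> I f \<le> \<mu> p I f powr (1 + noise_gain p \<rho>)"
  using noise_form_le_powr[of p \<rho> I f f] assms
  by (simp add: Stab_eq_noise_form powr_add[symmetric])

lemma Stab_nonneg:
  assumes "finite I" "\<And>x. x \<in> cube I \<Longrightarrow> 0 \<le> f x"
  shows "0 \<le> Stab p \<rho> I f"
  unfolding Stab_eq_noise_form noise_form_def
  using assms by (intro \<mu>_nonneg mult_nonneg_nonneg noise_op_nonneg)

section \<open>Noise sensitivity from small-set expansion\<close>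

theorem theorem1p8:
  fixes p :: real and f :: "nat \<Rightarrow> (nat \<Rightarrow> bool) \<Rightarrow> real"
  assumes "0 < p" and "p \<le> 1 / 2"
    and "\<And>n x. x \<in> cube {1..n} \<Longrightarrow> f n x \<in> {0, 1}"
    and "weakly_global p f"
  shows "noise_sensitive p f"
  unfolding noise_sensitive_def
proof (intro allI impI, elim conjE)
  fix \<rho> :: real
  assume \<rho>: "0 < \<rho>" "\<rho> < 1"
  define m where "m = (\<lambda>n. \<mu> p {1..n} (f n))"
  define \<delta> where "\<delta> = noise_gain p \<rho>"
  have \<delta>: "0 < \<delta>" using assms \<rho> by (simp add: \<delta>_def noise_gain_pos)
  have f: "0 \<le> f n x" "f n x \<in> {0..1}" if "x \<in> cube {1..n}" for n x
    using assms(3)[OF that] by auto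
  have m: "0 \<le> m n" for n
    unfolding m_def using f by (intro \<mu>_nonneg) auto
  have "m \<longlonglongrightarrow> 0"
    using assms(4) by (auto simp: weakly_global_def m_def dest: smalloD_tendsto)
  then have lim: "(\<lambda>n. m n powr \<delta> + m n) \<longlonglongrightarrow> 0"
    using \<delta> m by (auto intro!: tendsto_eq_intros)
  \<comment> \<open>Both terms of the difference are nonnegative, so its absolute value is at most
    the sum of their upper bounds.\<close>
  have bound: "\<bar>Stab p \<rho> {1..n} (f n) - (m n)\<^sup>2\<bar> \<le> (m n powr \<delta> + m n) * m n" for n
  proof -
    have "Stab p \<rho> {1..n} (f n) \<le> m n powr (1 + \<delta>)"
      unfolding m_def \<delta>_def using assms(1,2) \<rho> f by (intro Stab_le_powr) auto
    also have "\<dots> = m n powr \<delta> * m n"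
      using m[of n] by (simp add: powr_add)
    finally have "Stab p \<rho> {1..n} (f n) \<le> m n powr \<delta> * m n" .
    moreover have "0 \<le> Stab p \<rho> {1..n} (f n)"
      using f by (intro Stab_nonneg) auto
    moreover have "0 \<le> m n powr \<delta> * m n"
      using m[of n] by simp
    ultimately show ?thesis
      by (simp add: distrib_right power2_eq_square abs_le_iff) (smt (verit) m mult_nonneg_nonneg)
  qed
  have "(\<lambda>n. Stab p \<rho> {1..n} (f n) - (m n)\<^sup>2) \<in> o(m)"
  \<comment> \<open>Working with the product form instead of a quotient covers the indices where
    \<open>m n = 0\<close>.\<close>
  proof (rule landau_o.smallI)
    fix c :: real
    assume "0 < c"
    with lim have "eventually (\<lambda>n. m n powr \<delta> + m n < c) sequentially"
      by (intro order_tendstoD)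
    then show "eventually (\<lambda>n. norm (Stab p \<rho> {1..n} (f n) - (m n)\<^sup>2) \<le> c * norm (m n)) sequentially"
    proof eventually_elim
      case (elim n)
      then have "(m n powr \<delta> + m n) * m n \<le> c * m n"
        using m by (intro mult_right_mono) auto
      then show ?case using bound[of n] m[of n] by simp
    qed
  qed
  then show "(\<lambda>n. Stab p \<rho> {1..n} (f n) - (\<mu> p {1..n} (f n))\<^sup>2) \<in> o(\<lambda>n. \<mu> p {1..n} (f n))"
    by (simp add: m_def)
qed

end
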